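(* The problem PartitionIntoCommonBases requires an exponential number of independence queries. That is, there exist a constant $c>1$ and infinitely many positive integers $n$ such that the following holds: for every deterministic algorithm which, given a finite set $S$ and independence oracles for two matroids $M_1=(S,\mathcal{I}_1)$ and $M_2=(S,\mathcal{I}_2)$, always correctly decides whether $S$ can be partitioned into common bases of $M_1$ and $M_2$, there is an instance with $|S|=n$ on which the algorithm makes at least $c^{n}$ oracle queries.
   Context: A matroid is a pair $M=(S,\mathcal{I})$ with finite ground set $S$ and family $\mathcal{I}\subseteq 2^S$ of independent sets; its bases are its maximal independent sets. A common basis of two matroids $M_1,M_2$ on the same ground set $S$ is a subset of $S$ that is a basis of both $M_1$ and $M_2$. PartitionIntoCommonBases: given matroids $M_1=(S,\mathcal{I}_1)$ and $M_2=(S,\mathcal{I}_2)$, find a partition of $S$ into common bases of $M_1$ and $M_2$ (in decision form: decide whether such a partition exists). Independence oracle model: the algorithm knows the ground set $S$, but accesses a matroid $M=(S,\mathcal{I})$ only through queries; one query consists of a subset $X\subseteq S$ (and the choice of which of the given matroids is queried), and the answer is whether $X$ is independent in that matroid. Only the number of queries is counted. *)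

theory Defs
  imports Complex_Main "HOL-Library.Disjoint_Sets"
begin

locale matroid =
  fixes S :: "'a set" and \<I> :: "'a set set"
  assumes finite_ground: "finite S"
    and indep_subset_ground: "X \<in> \<I> \<Longrightarrow> X \<subseteq> S"
    and empty_indep: "{} \<in> \<I>"
    and indep_mono: "X \<in> \<I> \<Longrightarrow> Y \<subseteq> X \<Longrightarrow> Y \<in> \<I>"
    and augmentation: "X \<in> \<I> \<Longrightarrow> Y \<in> \<I> \<Longrightarrow> card X < card Y \<Longrightarrow> \<exists>y\<in>Y - X. insert y X \<in> \<I>"

definition bases :: "'a set set \<Rightarrow> 'a set set" where
  "bases \<I> = {B \<in> \<I>. \<forall>X\<in>\<I>. B \<subseteq> X \<longrightarrow> X = B}"

definition partitionable_into_common_bases :: "'a set \<Rightarrow> 'a set set \<Rightarrow> 'a set set \<Rightarrow> bool" where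
  "partitionable_into_common_bases S \<I>\<^sub>1 \<I>\<^sub>2 \<longleftrightarrow>
     (\<exists>P. partition_on S P \<and> (\<forall>B\<in>P. B \<in> bases \<I>\<^sub>1 \<and> B \<in> bases \<I>\<^sub>2))"

datatype matroid_choice = First | Second

datatype 'a step = Query matroid_choice "'a set" | Answer bool

text \<open>
  A deterministic algorithm sees the ground set and, at each moment, the replies received so far
  (oldest first).  Its own earlier queries are determined by these data, so they are not recorded.
  No restriction is placed on computation between queries: only queries are counted.
\<close>

type_synonym 'a algorithm = "'a set \<Rightarrow> bool list \<Rightarrow> 'a step"

fun indep_reply :: "'a set set \<Rightarrow> 'a set set \<Rightarrow> matroid_choice \<Rightarrow> 'a set \<Rightarrow> bool" where
  "indep_reply \<I>\<^sub>1 \<I>\<^sub>2 First X \<longleftrightarrow> X \<in> \<I>\<^sub>1"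
| "indep_reply \<I>\<^sub>1 \<I>\<^sub>2 Second X \<longleftrightarrow> X \<in> \<I>\<^sub>2"

text \<open>
  The lists \<open>rs\<close> with \<open>reaches A S \<I>\<^sub>1 \<I>\<^sub>2 rs\<close> are the reply histories occurring in the run of
  \<open>A\<close> on the given instance; the length of \<open>rs\<close> is the number of queries made so far,
  repeated queries included.
\<close>

inductive reaches :: "'a algorithm \<Rightarrow> 'a set \<Rightarrow> 'a set set \<Rightarrow> 'a set set \<Rightarrow> bool list \<Rightarrow> bool"
  for A S \<I>\<^sub>1 \<I>\<^sub>2 where
  start: "reaches A S \<I>\<^sub>1 \<I>\<^sub>2 []"
| query: "reaches A S \<I>\<^sub>1 \<I>\<^sub>2 rs \<Longrightarrow> A S rs = Query i X \<Longrightarrow>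
    reaches A S \<I>\<^sub>1 \<I>\<^sub>2 (rs @ [indep_reply \<I>\<^sub>1 \<I>\<^sub>2 i X])"

definition halts_with :: "'a algorithm \<Rightarrow> 'a set \<Rightarrow> 'a set set \<Rightarrow> 'a set set \<Rightarrow> bool list \<Rightarrow> bool \<Rightarrow> bool" where
  "halts_with A S \<I>\<^sub>1 \<I>\<^sub>2 rs b \<longleftrightarrow> reaches A S \<I>\<^sub>1 \<I>\<^sub>2 rs \<and> A S rs = Answer b"

definition decides_partition_into_common_bases :: "'a algorithm \<Rightarrow> bool" where
  "decides_partition_into_common_bases A \<longleftrightarrow>
     (\<forall>S \<I>\<^sub>1 \<I>\<^sub>2. matroid S \<I>\<^sub>1 \<and> matroid S \<I>\<^sub>2 \<longrightarrow>
        (\<forall>rs i X. reaches A S \<I>\<^sub>1 \<I>\<^sub>2 rs \<and> A S rs = Query i X \<longrightarrow> X \<subseteq> S) \<and>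
        (\<exists>rs. halts_with A S \<I>\<^sub>1 \<I>\<^sub>2 rs (partitionable_into_common_bases S \<I>\<^sub>1 \<I>\<^sub>2)))"

end

theory Submission
  imports Defs
begin

text \<open>
  The proof is an adversary argument.  A sparse paving matroid of rank \<open>r\<close> has all sets of size
  less than \<open>r\<close> independent and all sets of size \<open>r\<close> too, except for a family of sets any two of
  which meet in at most \<open>r - 2\<close> elements.  An exceptional set can be made independent without
  affecting any other set, so an independence oracle reveals this only when asked about that very set.
  If exponentially many exceptional sets decide whether a partition exists, then exponentially many
  queries are needed.

  The exceptional sets must capture every partition into common bases, although they are pairwise
  at distance at least \<open>4\<close>.  The second matroid arranges this.  It is the cycle matroid of \<open>m\<close>
  disjoint copies of the complete graph \<open>K\<^sub>4\<close>.  Each copy contributes one of its three perfect matchings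
  as a rank-one summand of the first matroid; the remaining summand of the first matroid is
  a sparse paving matroid of rank \<open>2m\<close> on the other \<open>4m\<close> edges.  The bases of
  the second matroid contain half of the ground set, so a partition has two parts, which in each copy
  of \<open>K\<^sub>4\<close> are complementary spanning trees, each containing one edge of the chosen matching.  This
  forces each part to contain one of the other two matchings of the copy completely
  (lemma \<open>complementary_trees\<close>).  On the \<open>4m\<close> edges, each part is therefore one of \<open>2 ^ m\<close> transversals,
  which choose one of two pairs in every copy; distinct transversals differ in at least one pair on
  either side, as a sparse paving matroid requires.

  With all transversals dependent there is no partition (\<open>no_instance\<close>).  With one transversal and its
  complement made independent there is one (\<open>yes_instance\<close>).  A query tells the first instance
  apart from at most two of the others (\<open>few_distinguished\<close>), so at least \<open>2 ^ m / 2\<close> queries are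
  needed (\<open>fooling_set_bound\<close>), while the ground set has \<open>6m\<close> elements.
\<close>

section \<open>Runs of an algorithm\<close>

lemma reaches_step:
  assumes "reaches A S I J rs" "k < length rs"
  shows "\<exists>i X. A S (take k rs) = Query i X \<and> rs ! k = indep_reply I J i X"
  using assms
proof (induction rule: reaches.induct)
  case (query rs i X)
  then show ?case
    by (cases "k = length rs") (auto simp: nth_append)
qed simp

lemma halting_run_unique:
  assumes "halts_with A S I J rs b" "halts_with A S I J rs' b'"
  shows "rs = rs' \<and> b = b'"
proof -
  have agree: "take k xs = take k ys"
    if "reaches A S I J xs" "reaches A S I J ys" "k \<le> length xs" "k \<le> length ys" for k xs ys
    using that
  proof (induction k)
    case (Suc k)
    then show ?case
      using reaches_step[of A S I J xs k] reaches_step[of A S I J ys k]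
      by (auto simp: take_Suc_conv_app_nth)
  qed simp
  have le: "length ys \<le> length xs"
    if "halts_with A S I J xs b" "halts_with A S I J ys b'" for xs ys b b'
  proof (rule ccontr)
    assume "\<not> ?thesis"
    then have "take (length xs) ys = xs" and "length xs < length ys"
      using that agree[of xs ys "length xs"] by (auto simp: halts_with_def)
    then show False
      using that reaches_step[of A S I J ys "length xs"] by (auto simp: halts_with_def)
  qed
  have "length rs = length rs'"
    using assms le by (meson le_antisym)
  then have "rs = rs'"
    using assms agree[of rs rs' "length rs"] by (auto simp: halts_with_def)
  then show ?thesis
    using assms by (auto simp: halts_with_def)
qed

text \<open>
  The run depends on the instance only through the replies, so a second instance that gives the same
  replies to the queries of the run has the same run.
\<close>

lemma reaches_transfer:
  assumes "reaches A S I J rs"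
    and "\<And>k i X. k < length rs \<Longrightarrow> A S (take k rs) = Query i X \<Longrightarrow>
      indep_reply I J i X = indep_reply I' J' i X"
  shows "reaches A S I' J' rs"
  using assms
proof (induction rule: reaches.induct)
  case (query rs i X)
  have "reaches A S I' J' rs"
  proof (rule query.IH)
    fix k i X
    assume "k < length rs" "A S (take k rs) = Query i X"
    then show "indep_reply I J i X = indep_reply I' J' i X"
      using query.prems[of k i X] by simp
  qed
  moreover have "indep_reply I J i X = indep_reply I' J' i X"
    using query.prems[of "length rs" i X] query.hyps by simp
  ultimately show ?case
    using query.hyps reaches.query[of A S I' J' rs i X] by simp
qed (rule reaches.start)

text \<open>
  On the instance without a partition the algorithm halts with a negative answer.  If no query
  of this run had a different reply on some instance \<open>\<sigma>\<close>, the algorithm would give the same answer there,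
  which is wrong.  So each of the instances is ruled out by a query, and one query
  rules out at most \<open>d\<close> of them.
\<close>

lemma fooling_set_bound:
  assumes dec: "decides_partition_into_common_bases A"
    and I: "matroid S I" and J: "matroid S J"
    and I': "\<And>\<sigma>. \<sigma> \<in> \<Phi> \<Longrightarrow> matroid S (I' \<sigma>)"
    and no: "\<not> partitionable_into_common_bases S I J"
    and yes: "\<And>\<sigma>. \<sigma> \<in> \<Phi> \<Longrightarrow> partitionable_into_common_bases S (I' \<sigma>) J"
    and fin: "finite \<Phi>"
    and few: "\<And>X. card {\<sigma> \<in> \<Phi>. (X \<in> I) \<noteq> (X \<in> I' \<sigma>)} \<le> d"
  shows "\<exists>rs b. halts_with A S I J rs b \<and> card \<Phi> \<le> d * length rs"
proof -
  obtain rs where rs: "halts_with A S I J rs False"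
    using dec I J no unfolding decides_partition_into_common_bases_def by metis
  define Q where "Q k = (case A S (take k rs) of Query i X \<Rightarrow> X | Answer b \<Rightarrow> {})" for k
  \<comment> \<open>The instances ruled out by the \<open>k\<close>-th query; queries to the second matroid may be counted as well.\<close>
  define E where "E k = {\<sigma> \<in> \<Phi>. (Q k \<in> I) \<noteq> (Q k \<in> I' \<sigma>)}" for k
  have "\<Phi> \<subseteq> (\<Union>k<length rs. E k)"
  proof (rule subsetI, rule ccontr)
    fix \<sigma>
    assume \<sigma>: "\<sigma> \<in> \<Phi>" and un: "\<sigma> \<notin> (\<Union>k<length rs. E k)"
    have "reaches A S (I' \<sigma>) J rs"
    proof (rule reaches_transfer)
      show "reaches A S I J rs"
        using rs by (simp add: halts_with_def)
      fix k i X
      assume "k < length rs" and q: "A S (take k rs) = Query i X"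
      then have "(Q k \<in> I) = (Q k \<in> I' \<sigma>)"
        using \<sigma> un unfolding E_def by blast
      moreover have "Q k = X"
        using q by (simp add: Q_def)
      ultimately show "indep_reply I J i X = indep_reply (I' \<sigma>) J i X"
        by (cases i) simp_all
    qed
    then have "halts_with A S (I' \<sigma>) J rs False"
      using rs by (simp add: halts_with_def)
    moreover obtain rs' where "halts_with A S (I' \<sigma>) J rs' True"
      using dec I'[OF \<sigma>] J yes[OF \<sigma>] unfolding decides_partition_into_common_bases_def by metis
    ultimately show False
      using halting_run_unique by blast
  qed
  then have "card \<Phi> \<le> card (\<Union>k<length rs. E k)"
    using fin by (intro card_mono finite_UN_I) (auto simp: E_def)
  also have "\<dots> \<le> (\<Sum>k<length rs. card (E k))"
    by (rule card_UN_le) simp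
  also have "\<dots> \<le> (\<Sum>k<length rs. d)"
    unfolding E_def by (rule sum_mono) (rule few)
  finally show ?thesis
    using rs by (auto simp: mult.commute)
qed

section \<open>Sparse paving matroids\<close>

definition sparse_paving :: "'a set \<Rightarrow> nat \<Rightarrow> 'a set set \<Rightarrow> 'a set set" where
  "sparse_paving S r \<H> = {X. X \<subseteq> S \<and> card X \<le> r \<and> X \<notin> \<H>}"

text \<open>
  Augmentation can only fail at the top rank: if \<open>X\<close> has size \<open>r - 1\<close> and neither \<open>insert y X\<close> nor
  \<open>insert z X\<close> is independent, for different \<open>y\<close> and \<open>z\<close>, then these are two members of \<open>\<H>\<close> that
  share all of \<open>X\<close>, which is one element too many.
\<close>

lemma matroid_sparse_paving:
  assumes S: "finite S" and r: "r > 0"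
    and card_H: "\<And>H. H \<in> \<H> \<Longrightarrow> card H = r"
    and sparse: "\<And>H K. H \<in> \<H> \<Longrightarrow> K \<in> \<H> \<Longrightarrow> H \<noteq> K \<Longrightarrow> card (H \<inter> K) + 2 \<le> r"
  shows "matroid S (sparse_paving S r \<H>)"
proof
  show "finite S" by (rule S)
next
  fix X assume "X \<in> sparse_paving S r \<H>"
  then show "X \<subseteq> S" by (simp add: sparse_paving_def)
next
  show "{} \<in> sparse_paving S r \<H>"
    using r card_H by (force simp: sparse_paving_def)
next
  fix X Y assume X: "X \<in> sparse_paving S r \<H>" and sub: "Y \<subseteq> X"
  then have fX: "finite X"
    using S finite_subset by (auto simp: sparse_paving_def)
  have "Y \<notin> \<H>"
  proof
    assume Y: "Y \<in> \<H>"
    then have "card X \<le> card Y"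
      using X card_H by (simp add: sparse_paving_def)
    then have "Y = X"
      using fX sub card_seteq[of X Y] by simp
    then show False
      using X Y by (simp add: sparse_paving_def)
  qed
  moreover have "card Y \<le> card X"
    using fX sub by (rule card_mono)
  ultimately show "Y \<in> sparse_paving S r \<H>"
    using X sub by (auto simp: sparse_paving_def)
next
  fix X Y assume X: "X \<in> sparse_paving S r \<H>" and Y: "Y \<in> sparse_paving S r \<H>"
    and less: "card X < card Y"
  have fin: "finite X" "finite Y"
    using X Y S finite_subset by (auto simp: sparse_paving_def)
  show "\<exists>y\<in>Y - X. insert y X \<in> sparse_paving S r \<H>"
  proof (rule ccontr)
    assume contra: "\<not> ?thesis"
    have in_H: "insert y X \<in> \<H>" if "y \<in> Y - X" for y
      using that contra X Y less fin by (auto simp: sparse_paving_def)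
    obtain y where y: "y \<in> Y - X"
      using less fin card_mono[of X Y] by (metis DiffI not_le subsetI)
    have cX: "Suc (card X) = r"
      using card_H[OF in_H[OF y]] y fin by simp
    show False
    proof (cases "Y - X = {y}")
      case True
      then have "Y \<subseteq> insert y X" by blast
      moreover have "card (insert y X) \<le> card Y"
        using y less fin by simp
      ultimately have "Y = insert y X"
        using fin card_seteq[of "insert y X" Y] by simp
      then show False
        using in_H[OF y] Y by (simp add: sparse_paving_def)
    next
      case False
      then obtain z where z: "z \<in> Y - X" "z \<noteq> y"
        using y by blast
      have "insert y X \<inter> insert z X = X"
        using y z by blast
      moreover have "insert y X \<noteq> insert z X"
        using y z by blast
      ultimately have "card X + 2 \<le> r"
        using sparse[OF in_H[OF y] in_H[OF z(1)]] by simp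
      then show False
        using cX by simp
    qed
  qed
qed

lemma full_size_indep_is_basis:
  assumes "finite S" "X \<in> sparse_paving S r \<H>" "card X = r"
  shows "X \<in> bases (sparse_paving S r \<H>)"
  unfolding bases_def
proof (intro CollectI conjI ballI impI)
  fix Y assume Y: "Y \<in> sparse_paving S r \<H>" and sub: "X \<subseteq> Y"
  then have "finite Y" "card Y \<le> card X"
    using assms by (auto simp: sparse_paving_def intro: finite_subset)
  then show "Y = X"
    using sub card_seteq[of Y X] by simp
qed (rule assms)

text \<open>
  The independent set \<open>X\<close> ensures that the rank is \<open>r\<close>; without it, \<open>\<H>\<close> might contain all
  \<open>r\<close>-subsets of the ground set.
\<close>

lemma card_basis_sparse_paving:
  assumes M: "matroid S (sparse_paving S r \<H>)"
    and X: "X \<in> sparse_paving S r \<H>" "card X = r"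
    and B: "B \<in> bases (sparse_paving S r \<H>)"
  shows "card B = r"
proof (rule ccontr)
  assume "card B \<noteq> r"
  then have "card B < card X"
    using B X by (auto simp: bases_def sparse_paving_def)
  then obtain y where "y \<in> X - B" "insert y B \<in> sparse_paving S r \<H>"
    using matroid.augmentation[OF M, of B X] B X(1) by (auto simp: bases_def)
  then show False
    using B by (auto simp: bases_def)
qed

section \<open>Direct sums\<close>

text \<open>
  The summands are indexed by the values of a labelling \<open>g\<close> of the ground set, so that
  their ground sets, the fibres of \<open>g\<close>, are disjoint by construction.
\<close>

definition direct_sum :: "'a set \<Rightarrow> ('a \<Rightarrow> 'k) \<Rightarrow> ('k \<Rightarrow> 'a set set) \<Rightarrow> 'a set set" where
  "direct_sum S g \<F> = {X. X \<subseteq> S \<and> (\<forall>k. {x \<in> X. g x = k} \<in> \<F> k)}"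

lemma matroid_direct_sum:
  assumes S: "finite S" and M: "\<And>k. matroid {x \<in> S. g x = k} (\<F> k)"
  shows "matroid S (direct_sum S g \<F>)"
proof
  show "finite S" by (rule S)
next
  fix X assume "X \<in> direct_sum S g \<F>"
  then show "X \<subseteq> S" by (simp add: direct_sum_def)
next
  show "{} \<in> direct_sum S g \<F>"
    using matroid.empty_indep[OF M] by (simp add: direct_sum_def)
next
  fix X Y assume X: "X \<in> direct_sum S g \<F>" and sub: "Y \<subseteq> X"
  have "{y \<in> Y. g y = k} \<in> \<F> k" for k
  proof (rule matroid.indep_mono[OF M])
    show "{x \<in> X. g x = k} \<in> \<F> k"
      using X by (simp add: direct_sum_def)
  qed (use sub in blast)
  then show "Y \<in> direct_sum S g \<F>"
    using X sub by (auto simp: direct_sum_def)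
next
  fix X Y assume X: "X \<in> direct_sum S g \<F>" and Y: "Y \<in> direct_sum S g \<F>"
    and less: "card X < card Y"
  have card_blocks: "card Z = (\<Sum>k\<in>g ` S. card {z \<in> Z. g z = k})" if "Z \<subseteq> S" for Z
  proof -
    have "finite Z"
      using that S finite_subset by blast
    then have "card (\<Union>k\<in>g ` S. {z \<in> Z. g z = k}) = (\<Sum>k\<in>g ` S. card {z \<in> Z. g z = k})"
      using S by (intro card_UN_disjoint) auto
    moreover have "(\<Union>k\<in>g ` S. {z \<in> Z. g z = k}) = Z"
      using that by auto
    ultimately show ?thesis by simp
  qed
  have "\<exists>k. card {x \<in> X. g x = k} < card {y \<in> Y. g y = k}"
  proof (rule ccontr)
    assume "\<not> ?thesis"
    then have "card Y \<le> card X"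
      using card_blocks[of X] card_blocks[of Y] X Y
      by (simp add: direct_sum_def not_less sum_mono)
    then show False using less by simp
  qed
  then obtain k where "card {x \<in> X. g x = k} < card {y \<in> Y. g y = k}" by blast
  moreover have "{x \<in> X. g x = k} \<in> \<F> k" "{y \<in> Y. g y = k} \<in> \<F> k"
    using X Y by (simp_all add: direct_sum_def)
  ultimately obtain y where y: "y \<in> Y" "y \<notin> X" "g y = k"
    and ins: "insert y {x \<in> X. g x = k} \<in> \<F> k"
    using matroid.augmentation[OF M] by (smt (verit, ccfv_threshold) Diff_iff mem_Collect_eq)
  have "{x \<in> insert y X. g x = l} = (if l = k then insert y {x \<in> X. g x = k} else {x \<in> X. g x = l})" for l
    using y by auto
  then have "insert y X \<in> direct_sum S g \<F>"
    using X Y y ins by (auto simp: direct_sum_def)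
  then show "\<exists>y\<in>Y - X. insert y X \<in> direct_sum S g \<F>"
    using y by blast
qed

lemma bases_direct_sum:
  assumes M: "\<And>k. matroid {x \<in> S. g x = k} (\<F> k)"
  shows "B \<in> bases (direct_sum S g \<F>) \<longleftrightarrow> B \<subseteq> S \<and> (\<forall>k. {x \<in> B. g x = k} \<in> bases (\<F> k))"
proof
  assume B: "B \<in> bases (direct_sum S g \<F>)"
  then have ind: "B \<in> direct_sum S g \<F>" and max: "\<And>X. X \<in> direct_sum S g \<F> \<Longrightarrow> B \<subseteq> X \<Longrightarrow> X = B"
    by (auto simp: bases_def)
  have "{x \<in> B. g x = k} \<in> bases (\<F> k)" for k
    unfolding bases_def
  proof (intro CollectI conjI ballI impI)
    show "{x \<in> B. g x = k} \<in> \<F> k"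
      using ind by (simp add: direct_sum_def)
    fix Y assume Y: "Y \<in> \<F> k" and sub: "{x \<in> B. g x = k} \<subseteq> Y"
    have YS: "Y \<subseteq> {x \<in> S. g x = k}"
      using matroid.indep_subset_ground[OF M Y] .
    have "{x \<in> B \<union> Y. g x = l} = (if l = k then Y else {x \<in> B. g x = l})" for l
      using YS sub by auto
    then have "B \<union> Y \<in> direct_sum S g \<F>"
      using ind Y YS by (auto simp: direct_sum_def)
    then have "B \<union> Y = B"
      using max by blast
    then show "Y = {x \<in> B. g x = k}"
      using sub YS by blast
  qed
  then show "B \<subseteq> S \<and> (\<forall>k. {x \<in> B. g x = k} \<in> bases (\<F> k))"
    using ind by (simp add: direct_sum_def)
next
  assume B: "B \<subseteq> S \<and> (\<forall>k. {x \<in> B. g x = k} \<in> bases (\<F> k))"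
  show "B \<in> bases (direct_sum S g \<F>)"
    unfolding bases_def
  proof (intro CollectI conjI ballI impI)
    show "B \<in> direct_sum S g \<F>"
      using B by (simp add: direct_sum_def bases_def)
    fix X assume X: "X \<in> direct_sum S g \<F>" and sub: "B \<subseteq> X"
    have "{x \<in> X. g x = k} = {x \<in> B. g x = k}" for k
    proof -
      have "{x \<in> X. g x = k} \<in> \<F> k"
        using X by (simp add: direct_sum_def)
      moreover have "{x \<in> B. g x = k} \<subseteq> {x \<in> X. g x = k}"
        using sub by blast
      ultimately show ?thesis
        using B unfolding bases_def by blast
    qed
    then show "X = B" by blast
  qed
qed

section \<open>The gadget on the complete graph with four vertices\<close>

text \<open>
  The numbers \<open>6*i, \<dots>, 6*i+5\<close> stand for the edges \<open>13, 24, 14, 23, 12, 34\<close> of the \<open>i\<close>-th copy of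
  \<open>K\<^sub>4\<close> with vertices \<open>1, 2, 3, 4\<close>.  Consecutive pairs are its perfect matchings.  Two triangles share
  one edge, so the cycle matroid of \<open>K\<^sub>4\<close> is itself sparse paving of rank \<open>3\<close>, with the triangles
  as exceptional sets.
\<close>

definition triangles :: "nat \<Rightarrow> nat set set" where
  "triangles i = {{6*i, 6*i+3, 6*i+4}, {6*i+1, 6*i+2, 6*i+4}, {6*i, 6*i+2, 6*i+5}, {6*i+1, 6*i+3, 6*i+5}}"

lemma card_triangle: "T \<in> triangles i \<Longrightarrow> card T = 3"
  by (auto simp: triangles_def)

lemma card_triangle_Int:
  "T \<in> triangles i \<Longrightarrow> T' \<in> triangles i \<Longrightarrow> T \<noteq> T' \<Longrightarrow> card (T \<inter> T') = 1"
  unfolding triangles_def insert_iff empty_iff by (elim disjE; simp)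

text \<open>
  Two edges of a triangle share a vertex, which the edges of a matching do not.
\<close>

lemma triangle_pairs:
  assumes "T \<in> triangles i"
  shows "\<not> {6*i, 6*i+1} \<subseteq> T" "\<not> {6*i+2, 6*i+3} \<subseteq> T"
  using assms by (auto simp: triangles_def)

text \<open>
  The set \<open>B\<close> is a spanning tree with one of the edges \<open>12\<close> and \<open>34\<close>, hence with two edges of the
  four-cycle formed by the remaining edges.  If these two edges meet in a vertex, then together with
  the third edge they form either a triangle or the star of that vertex; the complement of a star is
  a triangle.  So the two edges are opposite in the four-cycle, that is, they form one of the
  matchings \<open>{13, 24}\<close> and \<open>{14, 23}\<close>.
\<close>

lemma complementary_trees:
  fixes i :: nat
  defines "G \<equiv> {6*i, 6*i+1, 6*i+2, 6*i+3, 6*i+4, 6*i+5}"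
  assumes B: "B \<subseteq> G" "card B = 3" "B \<notin> triangles i" and C: "G - B \<notin> triangles i"
    and sep: "\<not> {6*i+4, 6*i+5} \<subseteq> B" "\<not> {6*i+4, 6*i+5} \<subseteq> G - B"
  shows "(6*i+1 \<in> B \<longleftrightarrow> 6*i \<in> B) \<and> (6*i+2 \<in> B \<longleftrightarrow> 6*i \<notin> B) \<and> (6*i+3 \<in> B \<longleftrightarrow> 6*i \<notin> B)"
proof -
  have "card B = (\<Sum>j\<in>G \<inter> B. 1)"
    using B(1) by (simp add: Int_absorb1)
  also have "\<dots> = (\<Sum>j\<in>G. if j \<in> B then 1 else 0)"
    by (rule sum.inter_restrict) (simp add: G_def)
  finally have three: "(if 6*i \<in> B then 1 else 0) + (if 6*i+1 \<in> B then 1 else 0) + (if 6*i+2 \<in> B then 1 else 0)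
      + (if 6*i+3 \<in> B then 1 else 0) + (if 6*i+4 \<in> B then 1 else 0) + (if 6*i+5 \<in> B then 1 else 0) = (3::nat)"
    using B(2) by (simp add: G_def)
  have one: "6*i+4 \<in> B \<longleftrightarrow> 6*i+5 \<notin> B"
    using sep B(1) by (auto simp: G_def)
  have "finite B"
    using B(1) by (auto simp: G_def intro: finite_subset)
  then have eq: "T = B" if "T \<subseteq> B" "card T = 3" for T
    using that B(2) card_subset_eq by metis
  have tri: "\<not> T \<subseteq> B" if "T \<in> triangles i" for T
    using that eq card_triangle[OF that] B(3) by blast
  have "\<not> {6*i, 6*i+3, 6*i+4} \<subseteq> B" "\<not> {6*i+1, 6*i+2, 6*i+4} \<subseteq> B"
    "\<not> {6*i, 6*i+2, 6*i+5} \<subseteq> B" "\<not> {6*i+1, 6*i+3, 6*i+5} \<subseteq> B"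
    by (rule tri, simp add: triangles_def)+
  moreover have cotri: "\<not> T \<subseteq> B" if "G - T \<in> triangles i" "card T = 3" for T
    using that eq C by blast
  \<comment> \<open>The four stars of \<open>K\<^sub>4\<close> are the complements of its triangles.\<close>
  have co: "G - {6*i+1, 6*i+2, 6*i+5} \<in> triangles i" "G - {6*i, 6*i+3, 6*i+5} \<in> triangles i"
    "G - {6*i+1, 6*i+3, 6*i+4} \<in> triangles i" "G - {6*i, 6*i+2, 6*i+4} \<in> triangles i"
  proof -
    have "G - {6*i+1, 6*i+2, 6*i+5} = {6*i, 6*i+3, 6*i+4}" "G - {6*i, 6*i+3, 6*i+5} = {6*i+1, 6*i+2, 6*i+4}"
      "G - {6*i+1, 6*i+3, 6*i+4} = {6*i, 6*i+2, 6*i+5}" "G - {6*i, 6*i+2, 6*i+4} = {6*i+1, 6*i+3, 6*i+5}"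
      unfolding G_def by auto
    then show "G - {6*i+1, 6*i+2, 6*i+5} \<in> triangles i" "G - {6*i, 6*i+3, 6*i+5} \<in> triangles i"
      "G - {6*i+1, 6*i+3, 6*i+4} \<in> triangles i" "G - {6*i, 6*i+2, 6*i+4} \<in> triangles i"
      by (simp_all only: triangles_def insert_iff simp_thms)
  qed
  have "\<not> {6*i+1, 6*i+2, 6*i+5} \<subseteq> B" "\<not> {6*i, 6*i+3, 6*i+5} \<subseteq> B"
    "\<not> {6*i+1, 6*i+3, 6*i+4} \<subseteq> B" "\<not> {6*i, 6*i+2, 6*i+4} \<subseteq> B"
    using cotri[OF co(1)] cotri[OF co(2)] cotri[OF co(3)] cotri[OF co(4)] by simp_all
  ultimately show ?thesis
    using three one
    by (cases "6*i \<in> B"; cases "6*i+1 \<in> B"; cases "6*i+2 \<in> B"; cases "6*i+3 \<in> B"; cases "6*i+4 \<in> B"; simp)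
qed

section \<open>The hard instances\<close>

text \<open>
  The matchings \<open>{13, 24}\<close> and \<open>{14, 23}\<close> of the \<open>i\<close>-th copy of \<open>K\<^sub>4\<close>.
\<close>

definition side :: "nat \<Rightarrow> bool \<Rightarrow> nat set" where
  "side i b = (if b then {6*i, 6*i+1} else {6*i+2, 6*i+3})"

definition transversal :: "nat \<Rightarrow> nat set \<Rightarrow> nat set" where
  "transversal m \<sigma> = (\<Union>i<m. side i (i \<in> \<sigma>))"

text \<open>
  The summands of the first matroid: \<open>None\<close> labels the large one, formed by the edges of all
  four-cycles, and \<open>Some i\<close> the edges \<open>12\<close> and \<open>34\<close> of the \<open>i\<close>-th copy.
\<close>

definition component :: "nat \<Rightarrow> nat option" where
  "component s = (if s mod 6 < 4 then None else Some (s div 6))"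

text \<open>
  The set \<open>D\<close> describes which transversals are dependent; it is what the algorithm has to find out.
\<close>

definition first_matroid :: "nat \<Rightarrow> nat set set \<Rightarrow> nat set set" where
  "first_matroid m D = direct_sum {..<6*m} component
     (\<lambda>l. sparse_paving {s \<in> {..<6*m}. component s = l}
       (case l of None \<Rightarrow> 2*m | Some _ \<Rightarrow> 1)
       (case l of None \<Rightarrow> transversal m ` D | Some _ \<Rightarrow> {}))"

definition second_matroid :: "nat \<Rightarrow> nat set set" where
  "second_matroid m = direct_sum {..<6*m} (\<lambda>s. s div 6)
     (\<lambda>i. sparse_paving {s \<in> {..<6*m}. s div 6 = i} 3 (triangles i))"

lemma less_gadgets: "s < 6*m \<longleftrightarrow> s div 6 < m" for s m :: nat
  by (simp add: div_less_iff_less_mult mult.commute)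

text \<open>
  An edge is given by its copy \<open>s div 6\<close> and its position \<open>s mod 6\<close> in the copy.
\<close>

lemma gadget_coordinates:
  fixes i j s :: nat
  assumes "j < 6"
  shows "s = 6*i + j \<longleftrightarrow> s div 6 = i \<and> s mod 6 = j"
  using assms mult_div_mod_eq[of 6 s] by auto

lemma gadget_arith:
  fixes i :: nat
  shows "Suc (6*i) div 6 = i" "Suc (6*i) mod 6 = 1"
    "Suc (Suc (6*i)) div 6 = i" "Suc (Suc (6*i)) mod 6 = 2"
  using gadget_coordinates[of 1 "Suc (6*i)" i] gadget_coordinates[of 2 "Suc (Suc (6*i))" i]
  by simp_all

lemma mem_side: "s \<in> side i b \<longleftrightarrow> s div 6 = i \<and> s mod 6 < 4 \<and> (s mod 6 < 2 \<longleftrightarrow> b)"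
proof -
  have "s \<in> side i b \<longleftrightarrow> (if b then s = 6*i + 0 \<or> s = 6*i + 1 else s = 6*i + 2 \<or> s = 6*i + 3)"
    by (simp add: side_def)
  also have "\<dots> \<longleftrightarrow> s div 6 = i \<and> (if b then s mod 6 = 0 \<or> s mod 6 = 1 else s mod 6 = 2 \<or> s mod 6 = 3)"
    by (subst (1 2 3 4) gadget_coordinates; simp; blast)
  also have "\<dots> \<longleftrightarrow> s div 6 = i \<and> s mod 6 < 4 \<and> (s mod 6 < 2 \<longleftrightarrow> b)"
    by auto
  finally show ?thesis .
qed

lemma card_side: "finite (side i b)" "card (side i b) = 2"
  by (simp_all add: side_def)

lemma mem_transversal:
  "s \<in> transversal m \<sigma> \<longleftrightarrow> s < 6*m \<and> s mod 6 < 4 \<and> (s mod 6 < 2 \<longleftrightarrow> s div 6 \<in> \<sigma>)"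
  unfolding transversal_def less_gadgets UN_iff mem_side by auto

lemma finite_transversal: "finite (transversal m \<sigma>)"
  by (simp add: transversal_def card_side)

lemma card_transversal: "card (transversal m \<sigma>) = 2*m"
proof -
  have "card (transversal m \<sigma>) = (\<Sum>i<m. card (side i (i \<in> \<sigma>)))"
    unfolding transversal_def by (rule card_UN_disjoint) (auto simp: card_side mem_side)
  then show ?thesis by (simp add: card_side)
qed

text \<open>
  Where the index sets differ, the transversals choose disjoint pairs, and the whole pair is missing
  from the intersection.  Choosing single elements instead of pairs would not leave this
  gap of two, which sparse paving matroids need.
\<close>

lemma card_transversal_Int:
  assumes "\<sigma> \<subseteq> {..<m}" "\<tau> \<subseteq> {..<m}" "\<sigma> \<noteq> \<tau>"
  shows "card (transversal m \<sigma> \<inter> transversal m \<tau>) + 2 \<le> 2*m"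
proof -
  obtain i where i: "i < m" "i \<in> \<sigma> \<longleftrightarrow> i \<notin> \<tau>"
    using assms by blast
  define p where "p = side i (i \<in> \<sigma>)"
  have sub: "transversal m \<sigma> \<inter> transversal m \<tau> \<subseteq> transversal m \<sigma> - p"
    using i by (auto simp: mem_transversal p_def mem_side)
  have "p \<subseteq> transversal m \<sigma>"
    using i by (auto simp: transversal_def p_def)
  moreover have "finite p" "card p = 2"
    by (simp_all add: p_def card_side)
  ultimately have "card (transversal m \<sigma> - p) + 2 = 2*m"
    using card_transversal[of m \<sigma>] card_mono[OF finite_transversal, of p m \<sigma>] by (simp add: card_Diff_subset)
  then show ?thesis
    using card_mono[OF _ sub] finite_transversal by fastforce
qed

lemma inj_on_transversal: "inj_on (transversal m) (Pow {..<m})"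
proof (rule inj_onI, rule ccontr)
  fix \<sigma> \<tau>
  assume "\<sigma> \<in> Pow {..<m}" "\<tau> \<in> Pow {..<m}" "transversal m \<sigma> = transversal m \<tau>" "\<sigma> \<noteq> \<tau>"
  then show False
    using card_transversal_Int[of \<sigma> m \<tau>] card_transversal[of m \<tau>] by simp
qed

lemma gadget_block:
  fixes i :: nat
  shows "{s \<in> {..<6*m}. s div 6 = i} = (if i < m then {6*i, 6*i+1, 6*i+2, 6*i+3, 6*i+4, 6*i+5} else {})"
proof (rule set_eqI)
  fix s :: nat
  have "s div 6 = i \<longleftrightarrow> 6*i \<le> s \<and> s < 6*i + 6"
    using div_nat_eqI[of 6 i s] mult_div_mod_eq[of 6 s] by auto
  also have "\<dots> \<longleftrightarrow> s \<in> {6*i, 6*i+1, 6*i+2, 6*i+3, 6*i+4, 6*i+5}"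
    by auto
  finally have "s div 6 = i \<longleftrightarrow> s \<in> {6*i, 6*i+1, 6*i+2, 6*i+3, 6*i+4, 6*i+5}" .
  then show "s \<in> {s \<in> {..<6*m}. s div 6 = i} \<longleftrightarrow>
      s \<in> (if i < m then {6*i, 6*i+1, 6*i+2, 6*i+3, 6*i+4, 6*i+5} else {})"
    unfolding mem_Collect_eq lessThan_iff less_gadgets by (cases "i < m") auto
qed

lemma matroid_triangles:
  "matroid {s \<in> {..<6*m}. s div 6 = i} (sparse_paving {s \<in> {..<6*m}. s div 6 = i} 3 (triangles i))"
  by (rule matroid_sparse_paving) (simp_all add: card_triangle card_triangle_Int)

lemma matroid_transversals:
  assumes "m > 0" "D \<subseteq> Pow {..<m}"
  shows "matroid {s \<in> {..<6*m}. component s = l} (sparse_paving {s \<in> {..<6*m}. component s = l}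
       (case l of None \<Rightarrow> 2*m | Some _ \<Rightarrow> 1)
       (case l of None \<Rightarrow> transversal m ` D | Some _ \<Rightarrow> {}))"
proof (cases l)
  case None
  have "card (H \<inter> K) + 2 \<le> 2*m"
    if "H \<in> transversal m ` D" "K \<in> transversal m ` D" "H \<noteq> K" for H K
    using that assms card_transversal_Int by (smt (verit) PowD imageE subsetD)
  with None assms show ?thesis
    by (intro matroid_sparse_paving) (auto simp: card_transversal)
qed (auto intro!: matroid_sparse_paving)

lemma matroid_first: "m > 0 \<Longrightarrow> D \<subseteq> Pow {..<m} \<Longrightarrow> matroid {..<6*m} (first_matroid m D)"
  unfolding first_matroid_def by (rule matroid_direct_sum, simp, rule matroid_transversals)

lemma matroid_second: "matroid {..<6*m} (second_matroid m)"
  unfolding second_matroid_def by (rule matroid_direct_sum, simp, rule matroid_triangles)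

lemma basis_second_matroid:
  assumes B: "B \<in> bases (second_matroid m)" and i: "i < m"
  shows "card {s \<in> B. s div 6 = i} = 3" "{s \<in> B. s div 6 = i} \<notin> triangles i"
proof -
  let ?F = "sparse_paving {s \<in> {..<6*m}. s div 6 = i} 3 (triangles i)"
  have blk: "{s \<in> B. s div 6 = i} \<in> bases ?F"
    using B unfolding second_matroid_def bases_direct_sum[OF matroid_triangles] by blast
  have "{6*i, 6*i+1, 6*i+4} \<in> ?F"
    using i triangle_pairs(1)[of "{6*i, 6*i+1, 6*i+4}" i] unfolding sparse_paving_def gadget_block by auto
  then show "card {s \<in> B. s div 6 = i} = 3"
    using blk by (intro card_basis_sparse_paving[OF matroid_triangles _ _ blk, of "{6*i, 6*i+1, 6*i+4}"]) auto
  show "{s \<in> B. s div 6 = i} \<notin> triangles i"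
    using blk by (auto simp: bases_def sparse_paving_def)
qed

lemma first_matroid_pair:
  assumes B: "B \<in> first_matroid m D" and i: "i < m"
  shows "\<not> {6*i+4, 6*i+5} \<subseteq> B"
proof
  assume sub: "{6*i+4, 6*i+5} \<subseteq> B"
  have "component (6*i+4) = Some i" "component (6*i+5) = Some i"
    by (auto simp: component_def)
  then have "{6*i+4, 6*i+5} \<subseteq> {s \<in> B. component s = Some i}"
    using sub by auto
  moreover have "finite {s \<in> B. component s = Some i}"
    using B by (auto simp: first_matroid_def direct_sum_def intro: finite_subset)
  ultimately have "card {6*i+4, 6*i+5} \<le> card {s \<in> B. component s = Some i}"
    by (intro card_mono)
  also have "\<dots> \<le> 1"
  proof -
    have "{s \<in> B. component s = Some i} \<in> sparse_paving {s \<in> {..<6*m}. component s = Some i} 1 {}"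
      using B unfolding first_matroid_def direct_sum_def
      by (auto dest!: spec[of _ "Some i"])
    then show ?thesis by (simp add: sparse_paving_def)
  qed
  finally show False by simp
qed

text \<open>
  By \<open>complementary_trees\<close>, in every copy of \<open>K\<^sub>4\<close>, a part of a partition contains exactly one of the two
  matchings on the four-cycle; so on the large summand of the first matroid it is a
  transversal, which is dependent.
\<close>

lemma no_instance:
  assumes m: "m > 0"
  shows "\<not> partitionable_into_common_bases {..<6*m} (first_matroid m (Pow {..<m})) (second_matroid m)"
proof
  assume "partitionable_into_common_bases {..<6*m} (first_matroid m (Pow {..<m})) (second_matroid m)"
  then obtain P where P: "partition_on {..<6*m} P"
    and bas: "\<And>B. B \<in> P \<Longrightarrow> B \<in> bases (first_matroid m (Pow {..<m})) \<and> B \<in> bases (second_matroid m)"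
    unfolding partitionable_into_common_bases_def by blast
  have UP: "\<Union>P = {..<6*m}"
    using P by (simp add: partition_on_def)
  obtain B where B: "B \<in> P"
    using UP m by (metis Sup_empty all_not_in_conv lessThan_iff mult_pos_pos zero_less_numeral)
  have B1: "B \<in> first_matroid m (Pow {..<m})"
    using bas[OF B] by (simp add: bases_def)
  have BS: "B \<subseteq> {..<6*m}"
    using B UP by blast
  have half: "(6*i+1 \<in> B \<longleftrightarrow> 6*i \<in> B) \<and> (6*i+2 \<in> B \<longleftrightarrow> 6*i \<notin> B) \<and> (6*i+3 \<in> B \<longleftrightarrow> 6*i \<notin> B)" if i: "i < m" for i
  proof -
    let ?G = "{6*i, 6*i+1, 6*i+2, 6*i+3, 6*i+4, 6*i+5}"
    let ?blk = "\<lambda>C. {s \<in> C. s div 6 = i}"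
    have G: "?blk {..<6*m} = ?G"
      unfolding gadget_block using i by simp
    have "card (?blk B) = 3"
      using basis_second_matroid i bas[OF B] by blast
    then have "?blk B \<noteq> ?G" by auto
    moreover have BG: "?blk B \<subseteq> ?G"
      using BS G by blast
    ultimately obtain s where s: "s \<in> ?G" "s \<notin> B" "s div 6 = i"
      using G by blast
    then have "s \<in> {..<6*m}"
      using G by blast
    then obtain C where C: "C \<in> P" "s \<in> C"
      using UP by blast
    have disj: "B \<inter> C = {}"
      using P B C s by (metis disjointD partition_on_def)
    have C3: "card (?blk C) = 3" "?blk C \<notin> triangles i"
      using basis_second_matroid i bas[OF C(1)] by blast+
    \<comment> \<open>Any part meeting the rest of this copy of \<open>K\<^sub>4\<close> has rank \<open>3\<close> there, so it exhausts the rest.\<close>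
    have "?blk C = ?G - ?blk B"
    proof (rule card_subset_eq)
      show "?blk C \<subseteq> ?G - ?blk B"
        using disj G UP C(1) by blast
      have "card (?G - ?blk B) = card ?G - card (?blk B)"
        using BG finite_subset by (intro card_Diff_subset) auto
      then show "card (?blk C) = card (?G - ?blk B)"
        using C3 \<open>card (?blk B) = 3\<close> by simp
    qed simp
    moreover have "\<not> {6*i+4, 6*i+5} \<subseteq> ?blk C"
      using first_matroid_pair[of C m _ i] bas[OF C(1)] i by (auto simp: bases_def)
    moreover have "\<not> {6*i+4, 6*i+5} \<subseteq> ?blk B"
      using first_matroid_pair[OF B1 i] by auto
    ultimately show ?thesis
      using complementary_trees[of "?blk B" i] BG \<open>card (?blk B) = 3\<close> C3
        basis_second_matroid(2)[OF _ i] bas[OF B] by (simp add: gadget_arith)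
  qed
  define \<sigma> where "\<sigma> = {i \<in> {..<m}. 6*i \<in> B}"
  have "s \<in> B \<and> component s = None \<longleftrightarrow> s \<in> transversal m \<sigma>" for s
  proof (cases "s < 6*m \<and> s mod 6 < 4")
    case True
    define i j where "i = s div 6" and "j = s mod 6"
    have s: "s = 6*i + j" and j: "j < 4" and i: "i < m"
      using True by (auto simp: i_def j_def)
    have "j = 0 \<or> j = 1 \<or> j = 2 \<or> j = 3"
      using j by auto
    then have "s \<in> B \<longleftrightarrow> (j < 2 \<longleftrightarrow> i \<in> \<sigma>)"
      using half[OF i] i unfolding s \<sigma>_def by (elim disjE) simp_all
    then show ?thesis
      using True by (simp add: mem_transversal component_def i_def j_def)
  next
    case False
    then show ?thesis
      using BS by (auto simp: mem_transversal component_def)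
  qed
  then have "{s \<in> B. component s = None} = transversal m \<sigma>" by blast
  moreover have "\<sigma> \<subseteq> {..<m}"
    by (auto simp: \<sigma>_def)
  moreover have "{s \<in> B. component s = None} \<notin> transversal m ` Pow {..<m}"
    using B1 unfolding first_matroid_def direct_sum_def
    by (auto dest!: spec[of _ None] simp: sparse_paving_def)
  ultimately show False by blast
qed

text \<open>
  A transversal is completed by an edge of the remaining matching in every copy: \<open>12\<close> for \<open>e = 4\<close>
  and \<open>34\<close> for \<open>e = 5\<close>.
\<close>

definition part :: "nat \<Rightarrow> nat set \<Rightarrow> nat \<Rightarrow> nat set" where
  "part m \<tau> e = (\<Union>i<m. insert (6*i + e) (side i (i \<in> \<tau>)))"

lemma mem_part:
  assumes "e \<in> {4, 5}"
  shows "s \<in> part m \<tau> e \<longleftrightarrow> s < 6*m \<and> (s mod 6 = e \<or> s mod 6 < 4 \<and> (s mod 6 < 2 \<longleftrightarrow> s div 6 \<in> \<tau>))"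
proof -
  have "s = 6*i + e \<longleftrightarrow> s div 6 = i \<and> s mod 6 = e" for i
    using assms by (intro gadget_coordinates) auto
  then show ?thesis
    unfolding part_def less_gadgets UN_iff insert_iff mem_side by auto
qed

lemma part_block:
  assumes "i < m" "e \<in> {4, 5}"
  shows "{s \<in> part m \<tau> e. s div 6 = i} = insert (6*i + e) (side i (i \<in> \<tau>))"
  using assms by (auto simp: part_def mem_side)

text \<open>
  In a copy of \<open>K\<^sub>4\<close>, a matching together with one further edge is a path of length three, hence a
  spanning tree.
\<close>

lemma part_in_bases:
  assumes m: "m > 0" and D: "D \<subseteq> Pow {..<m}" and \<tau>: "\<tau> \<subseteq> {..<m}" "\<tau> \<notin> D" and e: "e \<in> {4, 5}"
  shows "part m \<tau> e \<in> bases (first_matroid m D)" "part m \<tau> e \<in> bases (second_matroid m)"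
proof -
  have sub: "part m \<tau> e \<subseteq> {..<6*m}"
    using mem_part[OF e] by blast
  have empty: "{} \<in> bases (sparse_paving {} r \<H>)" if "{} \<notin> \<H>" for r and \<H> :: "nat set set"
    using that by (auto simp: bases_def sparse_paving_def)
  have "{s \<in> part m \<tau> e. component s = l} \<in> bases (sparse_paving {s \<in> {..<6*m}. component s = l}
       (case l of None \<Rightarrow> 2*m | Some _ \<Rightarrow> 1)
       (case l of None \<Rightarrow> transversal m ` D | Some _ \<Rightarrow> {}))" for l
  proof (cases l)
    case None
    have "{s \<in> part m \<tau> e. component s = None} = transversal m \<tau>"
      using e by (auto simp: mem_part mem_transversal component_def)
    moreover have "transversal m \<tau> \<notin> transversal m ` D"
      using D \<tau> inj_on_image_mem_iff[OF inj_on_transversal[of m], of \<tau> D] by blast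
    moreover have "transversal m \<tau> \<subseteq> {s \<in> {..<6*m}. component s = None}"
      by (auto simp: mem_transversal component_def)
    ultimately show ?thesis
      unfolding None option.case
      by (intro full_size_indep_is_basis) (simp_all add: sparse_paving_def card_transversal)
  next
    case (Some i)
    show ?thesis
    proof (cases "i < m")
      case True
      have comp: "component (6*i + e) = Some i" "6*i + e < 6*m"
        using e True by (auto simp: component_def)
      have "{s \<in> part m \<tau> e. component s = Some i} = {6*i + e}"
      proof (rule set_eqI)
        fix s
        have "s \<in> part m \<tau> e \<and> component s = Some i \<longleftrightarrow> s < 6*m \<and> s mod 6 = e \<and> s div 6 = i"
          using e by (auto simp: mem_part component_def)
        also have "\<dots> \<longleftrightarrow> s = 6*i + e"
          using e comp(2) gadget_coordinates[of e s i] by auto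
        finally show "s \<in> {s \<in> part m \<tau> e. component s = Some i} \<longleftrightarrow> s \<in> {6*i + e}" by simp
      qed
      then show ?thesis
        unfolding Some option.case using comp
        by (intro full_size_indep_is_basis) (simp_all add: sparse_paving_def)
    next
      case False
      have none: "{s \<in> {..<6*m}. component s = Some i} = {}"
        using False by (auto simp: component_def less_gadgets)
      then have none': "{s \<in> part m \<tau> e. component s = Some i} = {}"
        using sub by blast
      show ?thesis
        unfolding Some option.case none none' by (rule empty) simp
    qed
  qed
  then show "part m \<tau> e \<in> bases (first_matroid m D)"
    unfolding first_matroid_def bases_direct_sum[OF matroid_transversals[OF m D]]
    by (intro conjI allI sub)
  have "{s \<in> part m \<tau> e. s div 6 = i} \<in> bases (sparse_paving {s \<in> {..<6*m}. s div 6 = i} 3 (triangles i))" for i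
  proof (cases "i < m")
    case True
    let ?B = "{s \<in> part m \<tau> e. s div 6 = i}"
    have B: "?B = insert (6*i + e) (side i (i \<in> \<tau>))"
      using True e by (rule part_block)
    have "side i (i \<in> \<tau>) \<subseteq> ?B"
      unfolding B by blast
    then have "?B \<notin> triangles i"
      using triangle_pairs[of ?B i] by (cases "i \<in> \<tau>") (auto simp only: side_def if_True if_False)
    moreover have "card ?B = 3"
      unfolding B using e by (subst card_insert_disjoint) (auto simp: card_side mem_side)
    moreover have "?B \<subseteq> {s \<in> {..<6*m}. s div 6 = i}"
      using sub by blast
    ultimately show ?thesis
      by (intro full_size_indep_is_basis) (simp_all add: sparse_paving_def)
  next
    case False
    have none: "{s \<in> {..<6*m}. s div 6 = i} = {}"
      unfolding gadget_block using False by simp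
    then have none': "{s \<in> part m \<tau> e. s div 6 = i} = {}"
      using sub by blast
    show ?thesis
      unfolding none none' by (rule empty) (simp add: triangles_def)
  qed
  then show "part m \<tau> e \<in> bases (second_matroid m)"
    unfolding second_matroid_def bases_direct_sum[OF matroid_triangles]
    by (intro conjI allI sub)
qed

text \<open>
  The transversal of \<open>\<sigma>\<close> together with all edges \<open>12\<close>, and its complement, are the two parts.  They
  use complementary transversals, so both of these have to be independent.
\<close>

lemma yes_instance:
  assumes m: "m > 0" and \<sigma>: "\<sigma> \<subseteq> {..<m}"
  shows "partitionable_into_common_bases {..<6*m}
    (first_matroid m (Pow {..<m} - {\<sigma>, {..<m} - \<sigma>})) (second_matroid m)"
proof -
  let ?D = "Pow {..<m} - {\<sigma>, {..<m} - \<sigma>}"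
  let ?B = "part m \<sigma> 4"
  let ?C = "part m ({..<m} - \<sigma>) 5"
  have "s \<in> ?B \<longleftrightarrow> s < 6*m \<and> s \<notin> ?C" for s
  proof -
    have "s mod 6 < 4 \<or> s mod 6 = 4 \<or> s mod 6 = 5"
      by presburger
    then show ?thesis
      by (auto simp: mem_part less_gadgets)
  qed
  moreover have "?C \<subseteq> {..<6*m}"
    by (auto simp: mem_part)
  ultimately have "?B \<union> ?C = {..<6*m}" "?B \<inter> ?C = {}"
    by blast+
  moreover have "?B \<noteq> {}" "?C \<noteq> {}"
    using m by (auto simp: part_def)
  ultimately have "partition_on {..<6*m} {?B, ?C}"
    by (auto simp: partition_on_def disjoint_def)
  moreover have "?B \<in> bases (first_matroid m ?D)" "?B \<in> bases (second_matroid m)"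
    by (rule part_in_bases[of m ?D]; use m \<sigma> in auto)+
  moreover have "?C \<in> bases (first_matroid m ?D)" "?C \<in> bases (second_matroid m)"
    by (rule part_in_bases[of m ?D]; use m \<sigma> in auto)+
  ultimately show ?thesis
    unfolding partitionable_into_common_bases_def by blast
qed

text \<open>
  The two instances differ only in the sets whose trace on the large summand is the transversal of
  \<open>\<sigma>\<close> or of its complement.  As transversals determine their index sets, the trace of
  \<open>X\<close> leaves at most two possibilities for \<open>\<sigma>\<close>.
\<close>

lemma few_distinguished:
  "card {\<sigma> \<in> Pow {..<m}. (X \<in> first_matroid m (Pow {..<m})) \<noteq>
     (X \<in> first_matroid m (Pow {..<m} - {\<sigma>, {..<m} - \<sigma>}))} \<le> 2"
proof -
  define Y where "Y = {s \<in> X. component s = None}"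
  have dep: "X \<in> first_matroid m D \<longleftrightarrow> X \<in> first_matroid m {} \<and> Y \<notin> transversal m ` D" for D
    unfolding first_matroid_def direct_sum_def sparse_paving_def Y_def
    by (auto split: option.splits)
  let ?E = "{\<sigma> \<in> Pow {..<m}. (X \<in> first_matroid m (Pow {..<m})) \<noteq>
     (X \<in> first_matroid m (Pow {..<m} - {\<sigma>, {..<m} - \<sigma>}))}"
  have E: "\<exists>\<tau>\<in>{\<sigma>, {..<m} - \<sigma>}. Y = transversal m \<tau>" if "\<sigma> \<in> ?E" for \<sigma>
    using that dep[of "Pow {..<m}"] dep[of "Pow {..<m} - {\<sigma>, {..<m} - \<sigma>}"] by blast
  show ?thesis
  proof (cases "?E = {}")
    case False
    then obtain \<rho> where \<rho>: "\<rho> \<in> ?E"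
      unfolding ex_in_conv[symmetric] by (rule exE)
    obtain \<tau> where "\<tau> \<in> {\<rho>, {..<m} - \<rho>}" and Y: "Y = transversal m \<tau>"
      using E[OF \<rho>] by (rule bexE)
    then have \<tau>: "\<tau> \<subseteq> {..<m}"
      using \<rho> by auto
    have "?E \<subseteq> {\<tau>, {..<m} - \<tau>}"
    proof
      fix \<sigma> assume \<sigma>: "\<sigma> \<in> ?E"
      then have sub: "\<sigma> \<subseteq> {..<m}" by simp
      obtain \<upsilon> where \<upsilon>: "\<upsilon> \<in> {\<sigma>, {..<m} - \<sigma>}" and "Y = transversal m \<upsilon>"
        using E[OF \<sigma>] by (rule bexE)
      then have "transversal m \<upsilon> = transversal m \<tau>"
        using Y by metis
      moreover have "\<upsilon> \<in> Pow {..<m}"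
        using \<upsilon> sub by auto
      moreover have "\<tau> \<in> Pow {..<m}"
        using \<tau> by (rule PowI)
      ultimately have "\<upsilon> = \<tau>"
        by (rule inj_onD[OF inj_on_transversal])
      then have "\<sigma> = \<tau> \<or> \<sigma> = {..<m} - \<tau>"
        using \<upsilon> double_diff[OF sub order_refl] by auto
      then show "\<sigma> \<in> {\<tau>, {..<m} - \<tau>}" by simp
    qed
    then have "card ?E \<le> card {\<tau>, {..<m} - \<tau>}"
      by (rule card_mono[rotated]) simp
    also have "\<dots> \<le> 2"
      by (simp add: card_insert_if)
    finally show ?thesis .
  qed (metis (no_types, lifting) card.empty zero_le)
qed

lemma exponential_lower_bound:
  fixes A :: "nat algorithm"
  assumes m: "m > 0" and A: "decides_partition_into_common_bases A"
  shows "\<exists>rs b. halts_with A {..<6*m} (first_matroid m (Pow {..<m})) (second_matroid m) rs b \<and>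
    2 ^ m \<le> 2 * length rs"
proof -
  have "\<exists>rs b. halts_with A {..<6*m} (first_matroid m (Pow {..<m})) (second_matroid m) rs b \<and>
    card (Pow {..<m}) \<le> 2 * length rs"
  proof (rule fooling_set_bound[OF A, where I' = "\<lambda>\<sigma>. first_matroid m (Pow {..<m} - {\<sigma>, {..<m} - \<sigma>})"])
    show "matroid {..<6*m} (first_matroid m (Pow {..<m} - {\<sigma>, {..<m} - \<sigma>}))" for \<sigma>
      using m by (rule matroid_first) (rule Diff_subset)
    show "partitionable_into_common_bases {..<6*m}
        (first_matroid m (Pow {..<m} - {\<sigma>, {..<m} - \<sigma>})) (second_matroid m)"
      if "\<sigma> \<in> Pow {..<m}" for \<sigma>
      using m that by (intro yes_instance) auto
  qed (simp_all only: m matroid_first matroid_second no_instance few_distinguished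
      finite_Pow_iff finite_lessThan order_refl not_False_eq_True)
  then show ?thesis
    by (simp add: card_Pow)
qed

theorem theorem1:
  shows "\<exists>c::real. c > 1 \<and>
    infinite {n::nat. n > 0 \<and>
      (\<forall>A :: nat algorithm. decides_partition_into_common_bases A \<longrightarrow>
        (\<exists>S \<I>\<^sub>1 \<I>\<^sub>2 rs b. card S = n \<and> matroid S \<I>\<^sub>1 \<and> matroid S \<I>\<^sub>2 \<and>
          halts_with A S \<I>\<^sub>1 \<I>\<^sub>2 rs b \<and> real (length rs) \<ge> c ^ n))}"
    (is "\<exists>c. c > 1 \<and> infinite (?N c)")
proof (intro exI conjI)
  \<comment> \<open>With \<open>m = 2 * (k + 1)\<close> gadgets, the ground set has \<open>n = 12 * (k + 1)\<close> elements and the bound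
    \<open>2 ^ (m - 1)\<close> is at least \<open>2 ^ (m / 2) = 2 ^ (n / 12)\<close>.\<close>
  define c :: real where "c = root 12 2"
  show "root 12 2 > (1::real)" by simp
  have "12 * Suc k \<in> ?N c" for k
  proof (intro CollectI conjI allI impI)
    fix A :: "nat algorithm"
    assume A: "decides_partition_into_common_bases A"
    define m where "m = 2 * Suc k"
    obtain rs b where run: "halts_with A {..<6*m} (first_matroid m (Pow {..<m})) (second_matroid m) rs b"
      and long: "2 ^ m \<le> 2 * length rs"
      using exponential_lower_bound[OF _ A, of m] by (auto simp: m_def)
    have "c ^ (12 * Suc k) = (c ^ 12) ^ Suc k"
      by (rule power_mult)
    also have "\<dots> = 2 ^ Suc k"
      by (simp add: c_def)
    also have "\<dots> \<le> 2 ^ (2*k + 1)"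
      by (rule power_increasing) auto
    also have "\<dots> \<le> real (length rs)"
    proof -
      have "2 * 2 ^ (2*k + 1) \<le> 2 * length rs"
        using long by (simp add: m_def)
      then have "2 ^ (2*k + 1) \<le> length rs" by linarith
      then have "real (2 ^ (2*k + 1)) \<le> real (length rs)" by (rule of_nat_mono)
      then show ?thesis by simp
    qed
    finally have "real (length rs) \<ge> c ^ (12 * Suc k)" .
    moreover have "card {..<6*m} = 12 * Suc k"
      by (simp add: m_def)
    moreover have "matroid {..<6*m} (first_matroid m (Pow {..<m}))"
      by (rule matroid_first) (auto simp: m_def)
    ultimately show "\<exists>S \<I>\<^sub>1 \<I>\<^sub>2 rs b. card S = 12 * Suc k \<and> matroid S \<I>\<^sub>1 \<and> matroid S \<I>\<^sub>2 \<and>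
        halts_with A S \<I>\<^sub>1 \<I>\<^sub>2 rs b \<and> real (length rs) \<ge> c ^ (12 * Suc k)"
      using run matroid_second by blast
  qed simp
  then have "range (\<lambda>k. 12 * Suc k) \<subseteq> ?N c" by blast
  moreover have "inj (\<lambda>k::nat. 12 * Suc k)"
    by (rule injI) simp
  then have "infinite (range (\<lambda>k::nat. 12 * Suc k))"
    using finite_imageD infinite_UNIV_nat by blast
  ultimately have "infinite (?N c)"
    by (rule infinite_super)
  then show "infinite (?N (root 12 2))"
    unfolding c_def .
qed

end
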